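(* Let $H_1,\ldots,H_n$ ($n\ge 2$) be (closed) subspaces of a complex Hilbert space $H$. Let $X=H\oplus\ldots\oplus H$ ($n$ copies, orthogonal direct sum), $\Delta=\{(x,\ldots,x): x\in H\}\subset X$ and $\widetilde H=H_1\oplus\ldots\oplus H_n\subset X$. Then: (a) $\sum_{k=1}^n H_k$ is closed in $H$ if and only if $\Delta^{\perp}+\widetilde H$ is closed in $X$; (b) $\sum_{k=1}^n H_k=H$ if and only if $\Delta^{\perp}+\widetilde H=X$.
   Context: "Subspace" means closed linear subspace; sums of subspaces are algebraic sums. $\Delta^\perp$ is the orthogonal complement of $\Delta$ in $X$. *)

theory Defs
  imports "HOL-Analysis.Analysis"
begin

(* The library's inner products are real. The inner product here is linear in the first argument
   and conjugate-linear in the second; norm and topology are those of real_normed_vector. *)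
class complex_inner = real_normed_vector +
  fixes scaleC :: "complex \<Rightarrow> 'a \<Rightarrow> 'a" (infixr "*\<^sub>C" 75)
    and cinner :: "'a \<Rightarrow> 'a \<Rightarrow> complex"
  assumes scaleC_add_right: "c *\<^sub>C (x + y) = c *\<^sub>C x + c *\<^sub>C y"
    and scaleC_add_left: "(c + d) *\<^sub>C x = c *\<^sub>C x + d *\<^sub>C x"
    and scaleC_scaleC: "c *\<^sub>C (d *\<^sub>C x) = (c * d) *\<^sub>C x"
    and scaleC_of_real: "complex_of_real r *\<^sub>C x = r *\<^sub>R x"
    and cinner_commute: "cinner x y = cnj (cinner y x)"
    and cinner_add_left: "cinner (x + y) z = cinner x z + cinner y z"
    and cinner_scaleC_left: "cinner (c *\<^sub>C x) y = c * cinner x y"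
    and cinner_self: "cinner x x = complex_of_real ((norm x)\<^sup>2)"

class complex_hilbert_space = complex_inner + complete_space

global_interpretation complex_vector: vector_space "scaleC :: complex \<Rightarrow> 'a \<Rightarrow> 'a::complex_inner"
  defines csubspace = complex_vector.subspace
proof
  fix x :: 'a
  show "1 *\<^sub>C x = x"
    using scaleC_of_real[of 1 x] by simp
qed (simp_all add: scaleC_add_right scaleC_add_left scaleC_scaleC)

(* The orthogonal direct sum of CARD('n) copies of 'a. The norm and the topology of 'a ^ 'n are
   the library's (the l2 norm and the product topology). *)
instantiation vec :: (complex_inner, finite) complex_inner
begin

definition scaleC_vec :: "complex \<Rightarrow> 'a ^ 'b \<Rightarrow> 'a ^ 'b" where
  "scaleC_vec c x = (\<chi> i. c *\<^sub>C (x $ i))"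

definition cinner_vec :: "'a ^ 'b \<Rightarrow> 'a ^ 'b \<Rightarrow> complex" where
  "cinner_vec x y = (\<Sum>i\<in>UNIV. cinner (x $ i) (y $ i))"

instance
proof
  fix x y z :: "'a ^ 'b" and c d :: complex and r :: real
  show "c *\<^sub>C (x + y) = c *\<^sub>C x + c *\<^sub>C y"
    by (simp add: scaleC_vec_def vec_eq_iff scaleC_add_right)
  show "(c + d) *\<^sub>C x = c *\<^sub>C x + d *\<^sub>C x"
    by (simp add: scaleC_vec_def vec_eq_iff scaleC_add_left)
  show "c *\<^sub>C (d *\<^sub>C x) = (c * d) *\<^sub>C x"
    by (simp add: scaleC_vec_def vec_eq_iff scaleC_scaleC)
  show "complex_of_real r *\<^sub>C x = r *\<^sub>R x"
    by (simp add: scaleC_vec_def vec_eq_iff scaleC_of_real)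
  show "cinner x y = cnj (cinner y x)"
    unfolding cinner_vec_def cnj_sum by (intro sum.cong refl cinner_commute)
  show "cinner (x + y) z = cinner x z + cinner y z"
    by (simp add: cinner_vec_def cinner_add_left sum.distrib)
  show "cinner (c *\<^sub>C x) y = c * cinner x y"
    by (simp add: cinner_vec_def scaleC_vec_def cinner_scaleC_left sum_distrib_left)
  show "cinner x x = complex_of_real ((norm x)\<^sup>2)"
    by (simp add: cinner_vec_def cinner_self norm_vec_def L2_set_def sum_nonneg)
qed

end

instance vec :: (complex_hilbert_space, finite) complex_hilbert_space ..

definition orthogonal_complement :: "'a::complex_inner set \<Rightarrow> 'a set" where
  "orthogonal_complement S = {x. \<forall>y\<in>S. cinner x y = 0}"

definition diagonal :: "('a ^ 'n) set" where
  "diagonal = {(\<chi> k. x) |x. True}"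

definition direct_sum :: "('n \<Rightarrow> 'a set) \<Rightarrow> ('a ^ 'n) set" where
  "direct_sum H = {x. \<forall>k. x $ k \<in> H k}"

end

(* The orthogonal complement of the diagonal is the kernel of the addition map
   x \<mapsto> \<Sum>k. x $ k, so its sum with the direct sum of the H k is the preimage of \<Sum>k. H k under
   that map. The addition map is continuous with a continuous right inverse (a coordinate
   embedding), so a set is closed, or everything, exactly when its preimage is. *)
theory Submission
  imports Defs
begin

lemma cinner_zero_left: "cinner 0 y = 0"
  using cinner_add_left[of 0 0 y] by simp

lemma cinner_sum_left: "cinner (sum f A) y = (\<Sum>i\<in>A. cinner (f i) y)"
  by (induction A rule: infinite_finite_induct) (simp_all add: cinner_zero_left cinner_add_left)

text \<open>By additivity in the first argument, pairing \<open>x\<close> with a constant vector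
  amounts to pairing its coordinate sum with that constant.\<close>

lemma orthogonal_complement_diagonal:
  "orthogonal_complement (diagonal :: ('a::complex_inner ^ 'n) set) = {x. (\<Sum>k\<in>UNIV. x $ k) = 0}"
proof -
  have "cinner x (\<chi> k. y) = cinner (\<Sum>k\<in>UNIV. x $ k) y" for x :: "'a ^ 'n" and y
    by (simp add: cinner_vec_def cinner_sum_left)
  \<comment> \<open>Testing with \<open>y = s\<close> forces the norm of \<open>s\<close> to
    vanish.\<close>
  moreover have "(\<forall>y. cinner s y = 0) \<longleftrightarrow> s = 0" for s :: 'a
    using cinner_self[of s] by (auto simp: cinner_zero_left)
  moreover have "orthogonal_complement (diagonal :: ('a ^ 'n) set) = {x. \<forall>y. cinner x (\<chi> k. y) = 0}"
    unfolding orthogonal_complement_def diagonal_def by blast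
  ultimately show ?thesis
    by simp
qed

text \<open>Adding a kernel element keeps the coordinate sum; conversely, two vectors with equal
  coordinate sums differ by a kernel element.\<close>

lemma orthogonal_complement_diagonal_plus_direct_sum:
  fixes H :: "'n::finite \<Rightarrow> 'a::complex_inner set"
  shows "orthogonal_complement diagonal + direct_sum H
    = (\<lambda>x. \<Sum>k\<in>UNIV. x $ k) -` (\<Sum>k\<in>UNIV. H k)"
proof (intro equalityI subsetI)
  fix z :: "'a ^ 'n"
  assume "z \<in> orthogonal_complement diagonal + direct_sum H"
  then obtain x y where "z = x + y" "(\<Sum>k\<in>UNIV. x $ k) = 0" "\<forall>k. y $ k \<in> H k"
    by (auto simp: set_plus_def orthogonal_complement_diagonal direct_sum_def)
  then show "z \<in> (\<lambda>x. \<Sum>k\<in>UNIV. x $ k) -` (\<Sum>k\<in>UNIV. H k)"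
    by (auto simp: set_sum_alt sum.distrib)
next
  fix z :: "'a ^ 'n"
  assume "z \<in> (\<lambda>x. \<Sum>k\<in>UNIV. x $ k) -` (\<Sum>k\<in>UNIV. H k)"
  then obtain h where h: "(\<Sum>k\<in>UNIV. z $ k) = (\<Sum>k\<in>UNIV. h k)" "\<forall>k. h k \<in> H k"
    by (auto simp: set_sum_alt)
  \<comment> \<open>The summands \<open>h\<close> form a vector of the direct sum with the same
    coordinate sum as \<open>z\<close>, so the difference lies in the kernel.\<close>
  have "z = (z - (\<chi> k. h k)) + (\<chi> k. h k)"
    by simp
  moreover have "z - (\<chi> k. h k) \<in> orthogonal_complement diagonal"
    using h by (simp add: orthogonal_complement_diagonal sum_subtractf)
  moreover have "(\<chi> k. h k) \<in> direct_sum H"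
    using h by (simp add: direct_sum_def)
  ultimately show "z \<in> orthogonal_complement diagonal + direct_sum H"
    by (metis set_plus_intro)
qed

text \<open>Since \<open>f (g x) = x\<close>, pulling the preimage of \<open>S\<close> under
  \<open>f\<close> back along \<open>g\<close> returns \<open>S\<close> itself.\<close>

lemma closed_vimage_iff_right_inverse:
  assumes "continuous_on UNIV f" "continuous_on UNIV g" "\<And>x. f (g x) = x"
  shows "closed (f -` S) \<longleftrightarrow> closed S"
proof
  assume "closed (f -` S)"
  then have "closed (g -` (f -` S))"
    using assms(2) by (rule closed_vimage)
  then show "closed S"
    using assms(3) by (simp add: vimage_def)
qed (use assms(1) in \<open>simp add: closed_vimage\<close>)

theorem mainTheorem3:
  fixes H :: "'n::finite \<Rightarrow> 'a::complex_hilbert_space set"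
  assumes "CARD('n) \<ge> 2"
    and "\<And>k. csubspace (H k)"
    and "\<And>k. closed (H k)"
  shows "(closed (\<Sum>k\<in>UNIV. H k) \<longleftrightarrow>
           closed (orthogonal_complement (diagonal :: ('a ^ 'n) set) + direct_sum H)) \<and>
         ((\<Sum>k\<in>UNIV. H k) = UNIV \<longleftrightarrow>
           orthogonal_complement (diagonal :: ('a ^ 'n) set) + direct_sum H = UNIV)"
proof -
  let ?add = "\<lambda>x :: 'a ^ 'n. \<Sum>k\<in>UNIV. x $ k"
  \<comment> \<open>Any coordinate serves for the embedding; \<open>j\<close> fixes one.\<close>
  obtain j :: 'n where True
    by simp
  let ?embed = "\<lambda>a :: 'a. \<chi> k. if k = j then a else 0"
  have right_inverse: "?add (?embed a) = a" for a
    by simp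
  \<comment> \<open>The condition does not involve \<open>a\<close>, so each coordinate is either
    the identity or constantly zero.\<close>
  have "continuous_on UNIV (\<lambda>a. if k = j then a else (0 :: 'a))" for k
    by (cases "k = j") auto
  then have "continuous_on UNIV ?embed"
    by (intro continuous_on_vec_lambda)
  moreover have "continuous_on UNIV ?add"
    by (intro continuous_intros)
  ultimately have "closed (?add -` (\<Sum>k\<in>UNIV. H k)) \<longleftrightarrow> closed (\<Sum>k\<in>UNIV. H k)"
    using right_inverse by (intro closed_vimage_iff_right_inverse)
  moreover have "?add -` (\<Sum>k\<in>UNIV. H k) = UNIV \<longleftrightarrow> (\<Sum>k\<in>UNIV. H k) = UNIV"
    \<comment> \<open>By surjectivity, the image of a preimage is the original set, so only
      \<open>UNIV\<close> has preimage \<open>UNIV\<close>.\<close>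
    using surjI[of ?add, OF right_inverse] by (metis surj_image_vimage_eq vimage_UNIV)
  ultimately show ?thesis
    by (simp add: orthogonal_complement_diagonal_plus_direct_sum)
qed

end
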